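(* Let $C$ and $C'$ be smooth $d$-dimensional combinatorial cubes in $\mathbb{R}^d$ which are Minkowski equivalent. Then the pair $(C, C')$ is IDP, i.e. every lattice point of $C + C'$ is the sum of a lattice point of $C$ and a lattice point of $C'$.
   Context: A lattice polytope is the convex hull of finitely many points of $\mathbb{Z}^d$. A $d$-dimensional polytope is simple if each vertex lies in exactly $d$ edges. The primitive edge directions at a vertex are the smallest lattice vectors pointing along its incident edges. A $d$-dimensional lattice polytope in $\mathbb{R}^d$ is smooth if it is simple and at every vertex the primitive edge directions form a basis of $\mathbb{Z}^d$. A $d$-dimensional combinatorial cube is a polytope whose face poset is isomorphic to that of $[0,1]^d$. Two polytopes are Minkowski equivalent if they have the same normal fan. For lattice polytopes $P,Q$, the pair $(P,Q)$ is IDP if every lattice point of $P+Q$ is the sum of a lattice point of $P$ and a lattice point of $Q$. *)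

theory Defs
  imports "HOL-Analysis.Analysis"
begin

definition lattice_point :: "real^'n \<Rightarrow> bool" where
  "lattice_point x \<longleftrightarrow> (\<forall>i. x $ i \<in> \<int>)"

definition lattice_polytope :: "(real^'n) set \<Rightarrow> bool" where
  "lattice_polytope P \<longleftrightarrow> (\<exists>S. finite S \<and> (\<forall>x\<in>S. lattice_point x) \<and> P = convex hull S)"

definition full_dim :: "(real^'n) set \<Rightarrow> bool" where
  "full_dim P \<longleftrightarrow> aff_dim P = int CARD('n)"

definition simple_polytope :: "(real^'n) set \<Rightarrow> bool" where
  "simple_polytope P \<longleftrightarrow>
     (\<forall>v. v extreme_point_of P \<longrightarrow> card {e. e edge_of P \<and> v \<in> e} = CARD('n))"

definition primitive_vec :: "real^'n \<Rightarrow> bool" where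
  "primitive_vec u \<longleftrightarrow> lattice_point u \<and> u \<noteq> 0 \<and>
     (\<forall>s. 0 < s \<and> s < 1 \<longrightarrow> \<not> lattice_point (s *\<^sub>R u))"

definition prim_edge_dirs :: "(real^'n) set \<Rightarrow> real^'n \<Rightarrow> (real^'n) set" where
  "prim_edge_dirs P v = {u. primitive_vec u \<and>
      (\<exists>e. e edge_of P \<and> v \<in> e \<and> (\<exists>t>0. v + t *\<^sub>R u \<in> e))}"

definition lattice_basis :: "(real^'n) set \<Rightarrow> bool" where
  "lattice_basis B \<longleftrightarrow> finite B \<and> card B = CARD('n) \<and> independent B \<and>
     (\<forall>b\<in>B. lattice_point b) \<and>
     (\<forall>z. lattice_point z \<longrightarrow> (\<exists>c :: real^'n \<Rightarrow> int. z = (\<Sum>b\<in>B. of_int (c b) *\<^sub>R b)))"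

definition smooth_polytope :: "(real^'n) set \<Rightarrow> bool" where
  "smooth_polytope P \<longleftrightarrow> lattice_polytope P \<and> full_dim P \<and> simple_polytope P \<and>
     (\<forall>v. v extreme_point_of P \<longrightarrow> lattice_basis (prim_edge_dirs P v))"

text \<open>Combinatorial cube: face poset (all faces, including the empty face and P itself)
  isomorphic to that of the unit cube [0,1]^d.\<close>
definition comb_cube :: "(real^'n) set \<Rightarrow> bool" where
  "comb_cube P \<longleftrightarrow> polytope P \<and>
     (\<exists>f. bij_betw f {F. F face_of P} {G. G face_of (cbox (0::real^'n) 1)} \<and>
          (\<forall>F1 F2. F1 face_of P \<longrightarrow> F2 face_of P \<longrightarrow> (F1 \<subseteq> F2 \<longleftrightarrow> f F1 \<subseteq> f F2)))"

definition normal_cone :: "(real^'n) set \<Rightarrow> (real^'n) set \<Rightarrow> (real^'n) set" where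
  "normal_cone P F = {u. \<forall>x\<in>F. \<forall>y\<in>P. u \<bullet> y \<le> u \<bullet> x}"

definition normal_fan :: "(real^'n) set \<Rightarrow> (real^'n) set set" where
  "normal_fan P = {normal_cone P F | F. F face_of P \<and> F \<noteq> {}}"

definition minkowski_equivalent :: "(real^'n) set \<Rightarrow> (real^'n) set \<Rightarrow> bool" where
  "minkowski_equivalent P Q \<longleftrightarrow> normal_fan P = normal_fan Q"

definition minkowski_sum :: "(real^'n) set \<Rightarrow> (real^'n) set \<Rightarrow> (real^'n) set" where
  "minkowski_sum P Q = {x + y | x y. x \<in> P \<and> y \<in> Q}"

definition IDP_pair :: "(real^'n) set \<Rightarrow> (real^'n) set \<Rightarrow> bool" where
  "IDP_pair P Q \<longleftrightarrow> (\<forall>z. lattice_point z \<and> z \<in> minkowski_sum P Q \<longrightarrow>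
      (\<exists>x y. x \<in> P \<and> y \<in> Q \<and> lattice_point x \<and> lattice_point y \<and> z = x + y))"

end

theory Submission
  imports Defs
begin

text \<open>
  Choose a vertex of \<open>C\<close>, its primitive edge directions \<open>u i\<close>, and for each pair of opposite facets the
  linear functionals \<open>p i\<close> (minimal on the facet through that vertex) and \<open>q i\<close> (maximal on the opposite
  one), scaled to be 1 on \<open>u i\<close>. Smoothness at all vertices makes the matrix \<open>q k \<bullet> u i\<close> triangular up
  to a simultaneous permutation (geometrically, the toric variety is a Bott tower): a minimal cycle of
  nonzero off-diagonal entries would contradict unimodularity at the vertex obtained by switching all
  but one facet of the cycle. In this order the coordinates of a lattice point of \<open>C + C'\<close> can be split one
  after the other, because the fibre of each projection is a segment with integral end points over
  lattice points, and the lengths of the fibres of \<open>C\<close> and \<open>C'\<close> add up. For \<open>C'\<close>, only points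
  maximising the same functionals as the vertices of \<open>C\<close> are needed; these come from the common fan.
\<close>

section \<open>Triangular form and splitting of lattice points\<close>

text \<open>The last assumption describes the edge leaving the vertex \<open>S\<close> (the set of switched facets) in
  direction \<open>j\<close>; it replaces the statement that all principal minors of the matrix are 1.\<close>

locale dual_frame =
  fixes u p q :: "'n::finite \<Rightarrow> real^'n"
  assumes expand: "x = (\<Sum>i\<in>UNIV. (p i \<bullet> x) *\<^sub>R u i)"
    and p_u: "p i \<bullet> u j = (if i = j then 1 else 0)"
    and q_u: "q i \<bullet> u i = 1"
    and lattice_u: "lattice_point (u i)"
    and p_int: "lattice_point x \<Longrightarrow> p i \<bullet> x \<in> \<int>"
    and q_int: "lattice_point x \<Longrightarrow> q i \<bullet> x \<in> \<int>"
    and edge: "j \<notin> S \<Longrightarrow> \<exists>w. p j \<bullet> w = 1 \<and> q j \<bullet> w = 1 \<and> (\<forall>i\<in>S. q i \<bullet> w = 0)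
      \<and> (\<forall>i. i \<notin> S \<longrightarrow> i \<noteq> j \<longrightarrow> p i \<bullet> w = 0)"
begin

lemma q_expand: "q k \<bullet> x = (\<Sum>i\<in>UNIV. (p i \<bullet> x) * (q k \<bullet> u i))"
  by (subst expand[of x]) (simp add: inner_sum_right)

text \<open>In \<open>q_expand\<close> only the term \<open>i = k\<close> survives. This is how
  \<open>q k\<close> is traded for \<open>p k\<close> once the earlier coordinates vanish.\<close>

lemma q_single:
  assumes "\<And>i. i \<noteq> k \<Longrightarrow> p i \<bullet> x = 0 \<or> q k \<bullet> u i = 0"
  shows "q k \<bullet> x = p k \<bullet> x"
proof -
  have "q k \<bullet> x = (\<Sum>i\<in>UNIV. if i = k then p k \<bullet> x else 0)"
    unfolding q_expand[of k x] using assms q_u by (intro sum.cong) auto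
  then show ?thesis by simp
qed

text \<open>Draw an arc from \<open>k\<close> to \<open>i\<close> when
  \<open>q k \<bullet> u i \<noteq> 0\<close>. Without a sink, a smallest nonempty set
  \<open>M\<close> having no sink would be a single directed cycle. Following the vector given by
  \<open>edge\<close> around this cycle then forces \<open>p j \<bullet> w = 0\<close>, against
  \<open>p j \<bullet> w = 1\<close>.\<close>

lemma ex_sink:
  assumes "T \<noteq> {}"
  shows "\<exists>k\<in>T. \<forall>i\<in>T - {k}. q k \<bullet> u i = 0"
proof (rule ccontr)
  define bad where "bad T \<longleftrightarrow> T \<noteq> {} \<and> (\<forall>k\<in>T. \<exists>i\<in>T - {k}. q k \<bullet> u i \<noteq> 0)" for T
  assume "\<not> ?thesis"
  with assms have "bad T" by (auto simp: bad_def)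
  obtain M where "bad M" and min: "\<And>N. bad N \<Longrightarrow> card M \<le> card N"
    using ex_has_least_nat[of bad T card] \<open>bad T\<close> by auto
  have sub: "N = M" if "bad N" "N \<subseteq> M" for N
    using min[OF that(1)] that(2) by (meson card_seteq finite)
  have "\<forall>k\<in>M. \<exists>i. i \<in> M \<and> i \<noteq> k \<and> q k \<bullet> u i \<noteq> 0"
    using \<open>bad M\<close> unfolding bad_def by blast
  from bchoice[OF this] obtain s
    where s: "\<And>k. k \<in> M \<Longrightarrow> s k \<in> M \<and> s k \<noteq> k \<and> q k \<bullet> u (s k) \<noteq> 0"
    by blast
  \<comment> \<open>A nonempty subset closed under some choice \<open>t\<close> of out-neighbours
    has no sink either, so minimality makes it all of \<open>M\<close>.\<close>
  have closed: "N = M"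
    if "N \<noteq> {}" "N \<subseteq> M" "t ` N \<subseteq> N" "\<And>k. k \<in> M \<Longrightarrow> t k \<in> M \<and> t k \<noteq> k \<and> q k \<bullet> u (t k) \<noteq> 0"
    for N t
  proof (rule sub)
    show "bad N" unfolding bad_def using that by blast
  qed (use that in auto)
  \<comment> \<open>The image of \<open>s\<close> is itself closed under \<open>s\<close>; on the
    finite set \<open>M\<close>, surjectivity gives injectivity.\<close>
  have "s ` M = M"
    by (rule closed[of _ s]) (use s \<open>bad M\<close> in \<open>auto simp: bad_def\<close>)
  then have inj: "inj_on s M" by (simp add: eq_card_imp_inj_on)
  \<comment> \<open>A second out-neighbour of a vertex could replace the first one, which would then be missed.\<close>
  have only: "i = s k" if k: "k \<in> M" and i: "i \<in> M" "i \<noteq> k" "q k \<bullet> u i \<noteq> 0" for k i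
  proof (rule ccontr)
    assume ne: "i \<noteq> s k"
    let ?t = "s(k := i)"
    have t: "?t l \<in> M \<and> ?t l \<noteq> l \<and> q l \<bullet> u (?t l) \<noteq> 0" if "l \<in> M" for l
      using i s[OF that] by simp
    have "?t ` M = M"
    proof (rule closed[of "?t ` M" ?t])
      show "?t ` M \<noteq> {}" using k by blast
      show "?t ` M \<subseteq> M" "?t ` ?t ` M \<subseteq> ?t ` M" using t by blast+
    qed (use t in blast)+
    moreover have "s k \<notin> ?t ` M"
      using ne inj_onD[OF inj _ k] by auto
    ultimately show False using s[OF k] by simp
  qed
  obtain j where j: "j \<in> M" using \<open>bad M\<close> by (auto simp: bad_def)
  \<comment> \<open>All facets of the cycle are switched except the one at \<open>j\<close>;
    \<open>w\<close> points along the edge that switches it as well.\<close>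
  obtain w where w: "p j \<bullet> w = 1" "q j \<bullet> w = 1" "\<forall>i\<in>M - {j}. q i \<bullet> w = 0"
    "\<forall>i. i \<notin> M - {j} \<longrightarrow> i \<noteq> j \<longrightarrow> p i \<bullet> w = 0"
    using edge[of j "M - {j}"] by auto
  \<comment> \<open>Indices outside \<open>M\<close> drop out because \<open>p i\<close> vanishes on
    \<open>w\<close>, and those inside \<open>M\<close> other than \<open>k\<close> and
    \<open>s k\<close> because of \<open>only\<close>.\<close>
  have row: "q k \<bullet> w = p k \<bullet> w + (q k \<bullet> u (s k)) * (p (s k) \<bullet> w)" if k: "k \<in> M" for k
  proof -
    have "q k \<bullet> w = (\<Sum>i\<in>UNIV. if i = k then p k \<bullet> w else
        if i = s k then (q k \<bullet> u (s k)) * (p (s k) \<bullet> w) else 0)"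
      unfolding q_expand[of k w]
    proof (intro sum.cong refl)
      fix i
      consider "i = k" | "i = s k" "i \<noteq> k" | "i \<notin> M" "i \<noteq> s k" "i \<noteq> k" | "i \<in> M" "i \<noteq> s k" "i \<noteq> k" by blast
      then show "(p i \<bullet> w) * (q k \<bullet> u i) = (if i = k then p k \<bullet> w else
        if i = s k then (q k \<bullet> u (s k)) * (p (s k) \<bullet> w) else 0)"
      proof cases
        case 3 then show ?thesis using w(4) j by auto
      next
        case 4 then show ?thesis using only[OF k] by auto
      qed (auto simp: q_u)
    qed
    also have "\<dots> = (\<Sum>i\<in>UNIV. (if i = k then p k \<bullet> w else 0) +
        (if i = s k then (q k \<bullet> u (s k)) * (p (s k) \<bullet> w) else 0))"
      using s[OF k] by (intro sum.cong) auto
    finally show ?thesis by (simp add: sum.distrib)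
  qed
  \<comment> \<open>The row of \<open>j\<close> reads 1 = 1 +
    \<open>(q j \<bullet> u (s j)) * (p (s j) \<bullet> w)\<close>. The other rows carry this zero
    along \<open>s\<close>, so the zero set is closed and contains \<open>j\<close>.\<close>
  have "p (s j) \<bullet> w = 0" using row[OF j] w(1,2) s[OF j] by simp
  then have "{k\<in>M. p k \<bullet> w = 0} \<noteq> {}" using s[OF j] by blast
  moreover have "s ` {k\<in>M. p k \<bullet> w = 0} \<subseteq> {k\<in>M. p k \<bullet> w = 0}"
  proof clarify
    fix k assume k: "k \<in> M" "p k \<bullet> w = 0"
    then have "k \<noteq> j" using w(1) by auto
    then show "s k \<in> M \<and> p (s k) \<bullet> w = 0"
      using row[OF k(1)] k s[OF k(1)] w(3) by simp
  qed
  ultimately have "{k\<in>M. p k \<bullet> w = 0} = M"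
    by (intro closed[of _ s]) (simp_all add: s)
  with j have "p j \<bullet> w = 0" by blast
  with w(1) show False by simp
qed

section \<open>Points prescribed by the frame and the triangular order\<close>

text \<open>\<open>S\<close> lists the coordinates in which the \<open>q\<close> facet is chosen
  instead of the \<open>p\<close> facet. The extremality conditions are phrased by normal cones so
  that they pass from one polytope to another along inclusions of these cones.\<close>

definition cube_vertices :: "(real^'n) set \<Rightarrow> ('n set \<Rightarrow> real^'n) \<Rightarrow> bool" where
  "cube_vertices P V \<longleftrightarrow> (\<forall>S. V S \<in> P \<and> lattice_point (V S) \<and>
     (\<forall>i. (if i \<in> S then q i else - p i) \<in> normal_cone P {V S}))"

lemma cube_vertices_p:
  assumes "cube_vertices P V" "i \<notin> S" "x \<in> P"
  shows "p i \<bullet> V S \<le> p i \<bullet> x"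
proof -
  have "- p i \<in> normal_cone P {V S}" using assms unfolding cube_vertices_def by metis
  then show ?thesis using assms(3) by (simp add: normal_cone_def)
qed

lemma cube_vertices_q:
  assumes "cube_vertices P V" "i \<in> S" "x \<in> P"
  shows "q i \<bullet> x \<le> q i \<bullet> V S"
proof -
  have "q i \<in> normal_cone P {V S}" using assms unfolding cube_vertices_def by metis
  then show ?thesis using assms(3) by (simp add: normal_cone_def)
qed

lemma cube_vertices_mem: "cube_vertices P V \<Longrightarrow> V S \<in> P"
  and cube_vertices_lattice: "cube_vertices P V \<Longrightarrow> lattice_point (V S)"
  by (simp_all add: cube_vertices_def)

text \<open>Both points minimise \<open>p i\<close> over \<open>P\<close>.\<close>

lemma cube_vertices_p_eq:
  assumes "cube_vertices P V" "i \<notin> S"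
  shows "p i \<bullet> V S = p i \<bullet> V {}"
  using cube_vertices_p[OF assms(1)] cube_vertices_mem[OF assms(1)] assms(2)
  by (metis antisym empty_iff)

lemma cube_vertices_q_eq:
  assumes "cube_vertices P V" "i \<in> S"
  shows "q i \<bullet> V S = q i \<bullet> V UNIV"
  using cube_vertices_q[OF assms(1)] cube_vertices_mem[OF assms(1)] assms(2)
  by (metis antisym UNIV_I)

text \<open>Within the coordinates \<open>U\<close>, the facets chosen at any vertex
  have linearly independent normals.\<close>

definition independent_facets_on :: "'n set \<Rightarrow> bool" where
  "independent_facets_on U \<longleftrightarrow>
     (\<forall>d. (\<forall>i\<in>U. p i \<bullet> d = 0 \<or> q i \<bullet> d = 0) \<longrightarrow> (\<forall>i\<in>U. p i \<bullet> d = 0))"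

text \<open>A sink of the arc relation on the complement of \<open>U\<close>: \<open>q k\<close>
  depends only on the coordinates in \<open>insert k U\<close>, so \<open>k\<close> can come next in
  the triangular order.\<close>

definition sink_after :: "'n set \<Rightarrow> 'n \<Rightarrow> bool" where
  "sink_after U k \<longleftrightarrow> k \<notin> U \<and> (\<forall>i. i \<notin> U \<longrightarrow> i \<noteq> k \<longrightarrow> q k \<bullet> u i = 0)"

text \<open>Once the coordinates in \<open>U\<close> vanish, \<open>q k\<close> and
  \<open>p k\<close> agree, so either alternative at \<open>k\<close> kills the coordinate
  \<open>k\<close>.\<close>

lemma independent_facets_on_insert:
  assumes "independent_facets_on U" "sink_after U k"
  shows "independent_facets_on (insert k U)"
  unfolding independent_facets_on_def
proof (intro allI impI ballI)
  fix d i assume d: "\<forall>i\<in>insert k U. p i \<bullet> d = 0 \<or> q i \<bullet> d = 0" and i: "i \<in> insert k U"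
  have U: "\<forall>i\<in>U. p i \<bullet> d = 0" using assms(1) d unfolding independent_facets_on_def by blast
  then have "q k \<bullet> d = p k \<bullet> d"
    using assms(2) by (intro q_single) (auto simp: sink_after_def)
  then show "p i \<bullet> d = 0" using U d i by auto
qed

text \<open>As long as \<open>U\<close> is not everything, \<open>ex_sink\<close> applied to its
  complement supplies the next coordinate; independence is carried along as an invariant.\<close>

lemma triangular_induct [case_names empty insert]:
  assumes "Q {}" and "\<And>U k. independent_facets_on U \<Longrightarrow> sink_after U k \<Longrightarrow> Q U \<Longrightarrow> Q (insert k U)"
  shows "Q UNIV"
proof -
  have "Q UNIV" if "independent_facets_on U" "Q U" for U
    using that
  proof (induction "card (- U)" arbitrary: U rule: less_induct)
    case less
    show ?case
    proof (cases "U = UNIV")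
      case False
      then obtain k where k: "sink_after U k"
        using ex_sink[of "- U"] by (auto simp: sink_after_def)
      then have "- insert k U \<subset> - U" by (auto simp: sink_after_def)
      then have "card (- insert k U) < card (- U)" by (intro psubset_card_mono) auto
      then show ?thesis
        by (rule less.hyps) (use less.prems k in \<open>auto intro: independent_facets_on_insert assms(2)\<close>)
    qed (use less in simp)
  qed
  moreover have "independent_facets_on {}" by (simp add: independent_facets_on_def)
  ultimately show ?thesis using assms(1) by simp
qed

text \<open>The two points share every chosen facet except the one at \<open>k\<close>. Independence
  on \<open>U\<close> leaves only a multiple of \<open>u k\<close> as their difference, and its
  length is measured by \<open>q k\<close>, which is maximal at
  \<open>V (insert k S)\<close>.\<close>

lemma cube_vertex_insert:
  assumes V: "cube_vertices P V" and U: "independent_facets_on U" "sink_after U k" and S: "S \<subseteq> U"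
  shows "V (insert k S) = V S + (q k \<bullet> V UNIV - q k \<bullet> V S) *\<^sub>R u k"
proof -
  define d where "d = V (insert k S) - V S"
  have k: "k \<notin> U" using U(2) by (simp add: sink_after_def)
  have out: "p i \<bullet> d = 0" if "i \<notin> insert k S" for i
    using cube_vertices_p_eq[OF V, of i "insert k S"] cube_vertices_p_eq[OF V, of i S] that
    by (simp add: d_def inner_diff_right)
  have "q i \<bullet> d = 0" if "i \<in> S" for i
    using cube_vertices_q_eq[OF V, of i "insert k S"] cube_vertices_q_eq[OF V, of i S] that
    by (simp add: d_def inner_diff_right)
  then have "\<forall>i\<in>U. p i \<bullet> d = 0 \<or> q i \<bullet> d = 0" using out k by fastforce
  then have "\<forall>i\<in>U. p i \<bullet> d = 0" using U(1) by (simp add: independent_facets_on_def)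
  then have z: "p i \<bullet> d = 0" if "i \<noteq> k" for i using out[of i] that S by (cases "i \<in> U") auto
  have "d = (\<Sum>i\<in>UNIV. if i = k then (p k \<bullet> d) *\<^sub>R u k else 0)"
    by (subst expand[of d], intro sum.cong) (use z in auto)
  also have "\<dots> = (p k \<bullet> d) *\<^sub>R u k" by simp
  also have "p k \<bullet> d = q k \<bullet> d" using q_single[of k d] z by simp
  also have "\<dots> = q k \<bullet> V UNIV - q k \<bullet> V S"
    using cube_vertices_q_eq[OF V, of k "insert k S"] by (simp add: d_def inner_diff_right)
  finally show ?thesis by (simp add: d_def algebra_simps)
qed

section \<open>Fibres of the hulls and splitting of lattice points\<close>

lemma hull_vertices_p:
  assumes V: "cube_vertices P V" and x: "x \<in> convex hull (V ` Pow U)" and i: "i \<notin> U"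
  shows "p i \<bullet> x = p i \<bullet> V {}"
proof -
  have "convex hull (V ` Pow U) \<subseteq> {y. p i \<bullet> y = p i \<bullet> V {}}"
  proof (rule hull_minimal)
    show "V ` Pow U \<subseteq> {y. p i \<bullet> y = p i \<bullet> V {}}"
      using cube_vertices_p_eq[OF V, of i] i by blast
  qed (rule convex_hyperplane)
  then show ?thesis using x by auto
qed

lemma hull_vertices_q:
  assumes V: "cube_vertices P V" and x: "x \<in> convex hull (V ` Pow U)"
  shows "q i \<bullet> x \<le> q i \<bullet> V UNIV"
proof -
  have "convex hull (V ` Pow U) \<subseteq> {y. q i \<bullet> y \<le> q i \<bullet> V UNIV}"
    by (rule hull_minimal)
      (use cube_vertices_q[OF V, of i UNIV] cube_vertices_mem[OF V] in \<open>auto simp: convex_halfspace_le\<close>)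
  then show ?thesis using x by auto
qed

text \<open>The fibre above \<open>x\<close> in direction \<open>u k\<close> reaches up to the facet
  of \<open>q k\<close>: projecting along \<open>u k\<close> onto that facet's hyperplane sends each
  \<open>V S\<close> to \<open>V (insert k S)\<close>, hence the old hull into the new one. The
  point in question lies between \<open>x\<close> and its projection.\<close>

lemma hull_vertices_insert:
  assumes V: "cube_vertices P V" and U: "independent_facets_on U" "sink_after U k"
    and x: "x \<in> convex hull (V ` Pow U)"
    and t: "0 \<le> t" "t \<le> q k \<bullet> V UNIV - q k \<bullet> x"
  shows "x + t *\<^sub>R u k \<in> convex hull (V ` Pow (insert k U))"
proof -
  define \<beta> where "\<beta> = q k \<bullet> V UNIV"
  define \<phi> where "\<phi> y = \<beta> *\<^sub>R u k + (y - (q k \<bullet> y) *\<^sub>R u k)" for y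
  define L where "L y = y - (q k \<bullet> y) *\<^sub>R u k" for y
  have L: "linear L"
    unfolding L_def by (rule linearI) (simp_all add: algebra_simps inner_add_right)
  \<comment> \<open>\<open>\<phi>\<close> is a linear map followed by a translation, so it commutes
    with convex hulls.\<close>
  have \<phi>: "\<phi> ` A = (+) (\<beta> *\<^sub>R u k) ` L ` A" for A by (auto simp: \<phi>_def L_def image_image)
  have "\<phi> x \<in> \<phi> ` (convex hull (V ` Pow U))" using x by blast
  also have "\<dots> = convex hull (\<phi> ` V ` Pow U)"
    unfolding \<phi> by (simp only: convex_hull_linear_image[OF L] convex_hull_translation)
  also have "\<dots> \<subseteq> convex hull (V ` Pow (insert k U))"
  proof (rule hull_mono, clarify)
    fix S assume S: "S \<subseteq> U"
    have "\<phi> (V S) = V (insert k S)"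
      using cube_vertex_insert[OF V U S] by (simp add: \<phi>_def \<beta>_def algebra_simps)
    then show "\<phi> (V S) \<in> V ` Pow (insert k U)" using S by auto
  qed
  finally have 1: "\<phi> x \<in> convex hull (V ` Pow (insert k U))" .
  have 0: "x \<in> convex hull (V ` Pow (insert k U))"
    using x hull_mono[of "V ` Pow U" "V ` Pow (insert k U)"] by blast
  define h where "h = \<beta> - q k \<bullet> x"
  show ?thesis
  proof (cases "h = 0")
    case True
    then show ?thesis using 0 t by (simp add: h_def \<beta>_def)
  next
    case False
    then have h: "h > 0" using t by (simp add: h_def \<beta>_def)
    have "\<phi> x = x + h *\<^sub>R u k" by (simp add: \<phi>_def h_def algebra_simps)
    then have "(1 - t / h) *\<^sub>R x + (t / h) *\<^sub>R \<phi> x = x + t *\<^sub>R u k"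
      using h by (simp add: algebra_simps)
    moreover have "t / h \<le> 1" "0 \<le> t / h" using t h by (simp_all add: h_def \<beta>_def)
    ultimately show ?thesis
      using convexD[OF convex_convex_hull 0 1, of "1 - t / h" "t / h"] by simp
  qed
qed

lemma lattice_point_add_u:
  assumes "lattice_point x" "t \<in> \<int>"
  shows "lattice_point (x + t *\<^sub>R u k)"
  using assms lattice_u[of k] by (simp add: lattice_point_def)

text \<open>Lattice points \<open>x\<close> and \<open>y\<close> are built up along the triangular
  order; at stage \<open>U\<close> they lie in the hulls over \<open>Pow U\<close> and
  \<open>x + y\<close> agrees with \<open>z\<close> in the coordinates of \<open>U\<close>. The real
  decomposition \<open>a + a'\<close> serves only to bound \<open>p i\<close> and \<open>q i\<close>
  on \<open>z\<close>.\<close>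

lemma IDP_pair_cube_vertices:
  assumes V: "cube_vertices P V" and V': "cube_vertices P' V'" and "convex P" "convex P'"
  shows "IDP_pair P P'"
  unfolding IDP_pair_def
proof (intro allI impI, elim conjE)
  fix z :: "real^'n"
  assume z: "lattice_point z" and "z \<in> minkowski_sum P P'"
  then obtain a a' where a: "z = a + a'" "a \<in> P" "a' \<in> P'"
    by (auto simp: minkowski_sum_def)
  have pz: "p i \<bullet> V {} + p i \<bullet> V' {} \<le> p i \<bullet> z" for i
    using cube_vertices_p[OF V, of i "{}" a] cube_vertices_p[OF V', of i "{}" a'] a
    by (simp add: inner_add_right)
  have qz: "q i \<bullet> z \<le> q i \<bullet> V UNIV + q i \<bullet> V' UNIV" for i
    using cube_vertices_q[OF V, of i UNIV a] cube_vertices_q[OF V', of i UNIV a'] a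
    by (simp add: inner_add_right)
  have "\<exists>x y. x \<in> convex hull (V ` Pow UNIV) \<and> y \<in> convex hull (V' ` Pow UNIV) \<and>
      lattice_point x \<and> lattice_point y \<and> (\<forall>i\<in>UNIV. p i \<bullet> (z - x - y) = 0)"
  proof (induction rule: triangular_induct)
    case empty
    show ?case
      using cube_vertices_lattice[OF V] cube_vertices_lattice[OF V']
      by (intro exI[of _ "V {}"] exI[of _ "V' {}"]) simp
  next
    case (insert U k)
    then obtain x y where xy: "x \<in> convex hull (V ` Pow U)" "y \<in> convex hull (V' ` Pow U)"
      "lattice_point x" "lattice_point y" "\<forall>i\<in>U. p i \<bullet> (z - x - y) = 0" by blast
    have k: "k \<notin> U" using insert by (simp add: sink_after_def)
    \<comment> \<open>\<open>h\<close> and \<open>h'\<close> are the lengths of the fibres above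
      \<open>x\<close> and \<open>y\<close>, and \<open>c\<close> is the amount still missing in
      coordinate \<open>k\<close>. As much as possible is given to \<open>x\<close>, the rest to
      \<open>y\<close>.\<close>
    define h where "h = q k \<bullet> V UNIV - q k \<bullet> x"
    define h' where "h' = q k \<bullet> V' UNIV - q k \<bullet> y"
    define c where "c = p k \<bullet> (z - x - y)"
    define t where "t = min c h"
    have h0: "h \<ge> 0" "h' \<ge> 0"
      using hull_vertices_q[OF V xy(1)] hull_vertices_q[OF V' xy(2)] by (simp_all add: h_def h'_def)
    have c0: "c \<ge> 0"
      using hull_vertices_p[OF V xy(1) k] hull_vertices_p[OF V' xy(2) k] pz[of k]
      by (simp add: c_def inner_diff_right)
    \<comment> \<open>The remainder has zero coordinates in \<open>U\<close>, so its
      \<open>k\<close> coordinate can be read off by \<open>q k\<close>; the upper bound on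
      \<open>q k \<bullet> z\<close> thus becomes a bound on \<open>c\<close>.\<close>
    have "q k \<bullet> (z - x - y) = c"
      unfolding c_def using xy(5) insert(2) by (intro q_single) (auto simp: sink_after_def)
    then have hc: "c \<le> h + h'"
      using qz[of k] by (simp add: h_def h'_def inner_diff_right)
    have "lattice_point (z - x - y)" using z xy(3,4) by (simp add: lattice_point_def)
    then have "c \<in> \<int>" unfolding c_def by (rule p_int)
    moreover have "h \<in> \<int>"
      unfolding h_def using q_int[OF xy(3)] q_int[OF cube_vertices_lattice[OF V]] by simp
    ultimately have "t \<in> \<int>" "c - t \<in> \<int>" by (auto simp: t_def min_def)
    moreover have "x + t *\<^sub>R u k \<in> convex hull (V ` Pow (insert k U))"
      using h0 c0 by (intro hull_vertices_insert[OF V insert(1,2) xy(1)]) (auto simp: t_def h_def)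
    moreover have "y + (c - t) *\<^sub>R u k \<in> convex hull (V' ` Pow (insert k U))"
      using h0 c0 hc by (intro hull_vertices_insert[OF V' insert(1,2) xy(2)]) (auto simp: t_def h'_def)
    moreover have "p i \<bullet> (z - (x + t *\<^sub>R u k) - (y + (c - t) *\<^sub>R u k)) = 0" if "i \<in> insert k U" for i
    proof -
      have "z - (x + t *\<^sub>R u k) - (y + (c - t) *\<^sub>R u k) = z - x - y - c *\<^sub>R u k"
        by (simp add: algebra_simps)
      then have "p i \<bullet> (z - (x + t *\<^sub>R u k) - (y + (c - t) *\<^sub>R u k)) = p i \<bullet> (z - x - y) - c * (p i \<bullet> u k)"
        by (simp only: inner_diff_right inner_scaleR_right)
      then show ?thesis using that xy(5) k by (auto simp: p_u c_def)
    qed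
    ultimately show ?case
      using lattice_point_add_u[OF xy(3)] lattice_point_add_u[OF xy(4)]
      by (intro exI[of _ "x + t *\<^sub>R u k"] exI[of _ "y + (c - t) *\<^sub>R u k"]) simp
  qed
  then obtain x y where xy: "x \<in> convex hull (range V)" "y \<in> convex hull (range V')"
    "lattice_point x" "lattice_point y" "\<forall>i. p i \<bullet> (z - x - y) = 0" by auto
  have "z - x - y = 0" using expand[of "z - x - y"] xy(5) by simp
  then have "z = x + y" by (simp add: algebra_simps)
  moreover have "convex hull (range V) \<subseteq> P"
    by (rule hull_minimal) (use assms(3) cube_vertices_mem[OF V] in blast)+
  moreover have "convex hull (range V') \<subseteq> P'"
    by (rule hull_minimal) (use assms(4) cube_vertices_mem[OF V'] in blast)+
  ultimately show "\<exists>x y. x \<in> P \<and> y \<in> P' \<and> lattice_point x \<and> lattice_point y \<and> z = x + y"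
    using xy(1-4) by blast
qed

end

section \<open>Vertices, facets and edges of combinatorial cubes\<close>

definition cube_vertex :: "'n set \<Rightarrow> real^'n" where
  "cube_vertex S = (\<chi> i. if i \<in> S then 1 else 0)"

text \<open>The coordinates in \<open>A\<close> are frozen at those of the vertex \<open>S\<close>:
  \<open>A = {i}\<close> gives a facet, \<open>A = - {i}\<close> an edge and \<open>A = UNIV\<close>
  a vertex.\<close>

definition cube_face :: "'n set \<Rightarrow> 'n set \<Rightarrow> (real^'n) set" where
  "cube_face A S = {x \<in> cbox 0 1. \<forall>i\<in>A. x $ i = cube_vertex S $ i}"

lemma cube_vertex_in_face [simp]: "cube_vertex R \<in> cube_face A S \<longleftrightarrow> R \<inter> A = S \<inter> A"
  by (auto simp: cube_face_def cube_vertex_def mem_box_cart)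

lemma cube_face_UNIV [simp]: "cube_face UNIV S = {cube_vertex S}"
  by (auto simp: cube_face_def cube_vertex_def mem_box_cart vec_eq_iff)

lemma cube_face_face_of: "cube_face A S face_of cbox (0 :: real^'n) 1"
proof -
  have "cbox 0 1 \<inter> {x. axis i 1 \<bullet> x = cube_vertex S $ i} face_of cbox (0 :: real^'n) 1" for i
  proof (cases "i \<in> S")
    case True
    then show ?thesis
      by (intro face_of_Int_supporting_hyperplane_le)
        (auto simp: cube_vertex_def mem_box_cart inner_axis')
  next
    case False
    then show ?thesis
      by (intro face_of_Int_supporting_hyperplane_ge)
        (auto simp: cube_vertex_def mem_box_cart inner_axis')
  qed
  \<comment> \<open>The cube itself is inserted to keep the family nonempty when \<open>A\<close> is
    empty.\<close>
  then have "\<Inter> (insert (cbox 0 1) ((\<lambda>i. cbox 0 1 \<inter> {x. axis i 1 \<bullet> x = cube_vertex S $ i}) ` A))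
      face_of cbox (0 :: real^'n) 1"
    by (intro face_of_Inter) (auto simp: face_of_refl)
  also have "\<Inter> (insert (cbox 0 1) ((\<lambda>i. cbox 0 1 \<inter> {x. axis i 1 \<bullet> x = cube_vertex S $ i}) ` A)) =
      cube_face A S"
    by (auto simp: cube_face_def inner_axis')
  finally show ?thesis .
qed

lemma polytope_nonempty_extreme_point:
  fixes P :: "'a::euclidean_space set"
  assumes "polytope P" "F face_of P" "F \<noteq> {}"
  obtains v where "v extreme_point_of P" "v \<in> F"
proof -
  have "polytope F" using assms by (simp add: face_of_polytope_polytope)
  then obtain v where "v extreme_point_of F"
    using extreme_point_exists_convex[of F] assms(3)
    by (metis polytope_imp_compact polytope_imp_convex)
  then show thesis using that extreme_point_of_face[OF assms(2)] by blast
qed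

lemma cbox_face_contains_vertex:
  assumes "F face_of cbox (0 :: real^'n) 1" "F \<noteq> {}"
  obtains S where "cube_vertex S \<in> F"
proof -
  obtain v where v: "v extreme_point_of cbox (0 :: real^'n) 1" "v \<in> F"
    using polytope_nonempty_extreme_point[OF _ assms] by (auto simp: polytope_interval)
  then have "\<forall>i. v $ i = 0 \<or> v $ i = 1"
    using extreme_point_of_convex_hull[of v "{x. \<forall>i\<in>Basis. x \<bullet> i = 0 \<or> x \<bullet> i = 1}"]
    by (simp add: unit_interval_convex_hull Cart_1 cart_eq_inner_axis axis_in_Basis_iff)
  then have "v = cube_vertex {i. v $ i = 1}"
    by (auto simp: cube_vertex_def vec_eq_iff)
  then show thesis using that v(2) by metis
qed

definition toggle :: "'a \<Rightarrow> 'a set \<Rightarrow> 'a set" where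
  "toggle i S = (if i \<in> S then S - {i} else insert i S)"

lemma mem_toggle [simp]: "j \<in> toggle i S \<longleftrightarrow> (j \<in> S) \<noteq> (j = i)"
  by (auto simp: toggle_def)

lemma toggle_toggle [simp]: "toggle i (toggle i S) = S"
  by auto

text \<open>Vertices, facets and edges are pulled back through the inverse \<open>g\<close> of the
  face poset isomorphism. Incidence transfers because membership of a vertex in a face is an
  inclusion of faces.\<close>

lemma comb_cube_labelling:
  fixes P :: "(real^'n) set"
  assumes "comb_cube P"
  obtains V :: "'n set \<Rightarrow> real^'n" and F\<^sub>0 F\<^sub>1 :: "'n \<Rightarrow> (real^'n) set"
  where "\<And>S. V S extreme_point_of P"
    "\<And>i. F\<^sub>0 i face_of P" "\<And>S i. V S \<in> F\<^sub>0 i \<longleftrightarrow> i \<notin> S"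
    "\<And>i. F\<^sub>1 i face_of P" "\<And>S i. V S \<in> F\<^sub>1 i \<longleftrightarrow> i \<in> S"
    "\<And>S i. closed_segment (V S) (V (toggle i S)) edge_of P"
proof -
  obtain f where P: "polytope P"
    and f: "bij_betw f {F. F face_of P} {G. G face_of (cbox (0::real^'n) 1)}"
    and sub: "\<And>F G. F face_of P \<Longrightarrow> G face_of P \<Longrightarrow> F \<subseteq> G \<longleftrightarrow> f F \<subseteq> f G"
    using assms unfolding comb_cube_def by blast
  have face: "f F face_of cbox 0 1" if "F face_of P" for F
    using f that by (auto simp: bij_betw_def)
  have "\<exists>F. F face_of P \<and> f F = G" if "G face_of cbox 0 1" for G
    using f that unfolding bij_betw_def by (metis (mono_tags, lifting) imageE mem_Collect_eq)
  then obtain g where g: "\<And>G. G face_of cbox 0 1 \<Longrightarrow> g G face_of P \<and> f (g G) = G"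
    by metis
  have inj: "F = G" if "F face_of P" "G face_of P" "f F = f G" for F G
    using sub[OF that(1,2)] sub[OF that(2,1)] that(3) by auto
  have empty: "f {} = {}"
    using sub[of "{}" "g {}"] g[of "{}"] by (metis empty_face_of empty_subsetI subset_empty)
  have "\<exists>v. {v} face_of P \<and> f {v} = {cube_vertex S}" for S
  proof -
    have vert: "{cube_vertex S} face_of cbox 0 1" using cube_face_face_of[of UNIV S] by simp
    let ?F = "g {cube_vertex S}"
    have F: "?F face_of P" "f ?F = {cube_vertex S}" using g[OF vert] by auto
    then have "?F \<noteq> {}" using empty by auto
    then obtain v where v: "v extreme_point_of P" "v \<in> ?F"
      using polytope_nonempty_extreme_point[OF P F(1)] by blast
    then have v': "{v} face_of P" by (simp add: face_of_singleton)
    \<comment> \<open>The image of the vertex is a nonempty subset of a singleton, hence equal to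
      it.\<close>
    then have "f {v} \<subseteq> {cube_vertex S}" using sub[OF v' F(1)] v(2) F(2) by simp
    moreover have "f {v} \<noteq> {}" using inj[OF v', of "{}"] empty by auto
    ultimately show ?thesis using v' by auto
  qed
  then obtain V where V: "\<And>S. {V S} face_of P" "\<And>S. f {V S} = {cube_vertex S}" by metis
  have mem: "V R \<in> g (cube_face A S) \<longleftrightarrow> R \<inter> A = S \<inter> A" for R A S
    using sub[OF V(1)[of R], of "g (cube_face A S)"] g[OF cube_face_face_of[of A S]] V(2)[of R] by simp
  \<comment> \<open>Every extreme point carries a label; this is what limits the extreme points of
    an edge to two.\<close>
  have all: "\<exists>S. v = V S" if v: "v extreme_point_of P" for v
  proof -
    have v': "{v} face_of P" using v by (simp add: face_of_singleton)
    then have "f {v} \<noteq> {}" using inj[OF v', of "{}"] empty by auto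
    then obtain S where "cube_vertex S \<in> f {v}" using cbox_face_contains_vertex face[OF v'] by blast
    then show ?thesis using sub[OF V(1) v', of S] V(2)[of S] by auto
  qed
  show thesis
  proof
    show "V S extreme_point_of P" for S using V(1) by (simp add: face_of_singleton)
    show "g (cube_face {i} {}) face_of P" "g (cube_face {i} {i}) face_of P" for i
      using g cube_face_face_of by blast+
    show "V S \<in> g (cube_face {i} {}) \<longleftrightarrow> i \<notin> S" "V S \<in> g (cube_face {i} {i}) \<longleftrightarrow> i \<in> S" for S i
      by (auto simp: mem)
    show "closed_segment (V S) (V (toggle i S)) edge_of P" for S i
    proof -
      let ?E = "g (cube_face (- {i}) S)"
      have E: "?E face_of P" using g cube_face_face_of by blast
      have "{v. v extreme_point_of ?E} = {V S, V (toggle i S)}"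
      proof -
        have two: "R = S \<or> R = toggle i S" if R: "R \<inter> - {i} = S \<inter> - {i}" for R
        proof -
          have "j \<in> R \<longleftrightarrow> j \<in> S" if "j \<noteq> i" for j
            using R that by (auto dest: arg_cong[where f = "\<lambda>X. j \<in> X"])
          then show ?thesis
            unfolding set_eq_iff mem_toggle by metis
        qed
        have "v \<in> {V S, V (toggle i S)}" if v: "v extreme_point_of ?E" for v
        proof -
          have "v extreme_point_of P" "v \<in> ?E" using v extreme_point_of_face[OF E] by auto
          then obtain R where "v = V R" "V R \<in> ?E" using all by metis
          then show ?thesis using two[of R] mem[of R "- {i}" S] by auto
        qed
        moreover have "V S \<in> ?E" "V (toggle i S) \<in> ?E"
          by (auto simp: mem)
        ultimately show ?thesis
          using V(1) unfolding extreme_point_of_face[OF E] face_of_singleton by blast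
      qed
      moreover have "?E = convex hull {v. v extreme_point_of ?E}"
        using face_of_polytope_polytope[OF P E]
        by (intro Krein_Milman_Minkowski) (auto simp: polytope_imp_compact polytope_imp_convex)
      ultimately have eq: "?E = closed_segment (V S) (V (toggle i S))"
        by (simp add: segment_convex_hull)
      have "V S \<noteq> V (toggle i S)"
      proof
        assume "V S = V (toggle i S)"
        then have "cube_vertex S = cube_vertex (toggle i S)" using V(2)[of S] V(2)[of "toggle i S"] by simp
        then have "cube_vertex S $ i = cube_vertex (toggle i S) $ i" by simp
        then show False by (simp add: cube_vertex_def split: if_splits)
      qed
      then have "aff_dim ?E = 1" unfolding eq segment_convex_hull by (simp add: aff_dim_convex_hull)
      then show ?thesis using E eq by (simp add: edge_of_def)
    qed
  qed
qed

section \<open>Primitive edge directions and facet normals\<close>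

lemma lattice_basis_inner_int:
  assumes "lattice_basis B" "\<And>b. b \<in> B \<Longrightarrow> r \<bullet> b \<in> \<int>" "lattice_point z"
  shows "r \<bullet> z \<in> \<int>"
proof -
  obtain c where "z = (\<Sum>b\<in>B. of_int (c b) *\<^sub>R b)"
    using assms(1,3) unfolding lattice_basis_def by blast
  then have "r \<bullet> z = (\<Sum>b\<in>B. of_int (c b) * (r \<bullet> b))"
    by (simp add: inner_sum_right)
  also have "\<dots> \<in> \<int>" using assms(2) by (intro Ints_sum Ints_mult) auto
  finally show ?thesis .
qed

text \<open>On the lattice, \<open>r\<close> takes only integer multiples of the integer
  \<open>r \<bullet> w\<close>. Since 1 is among its values, \<open>r \<bullet> w\<close> is a
  positive unit.\<close>

lemma lattice_basis_inner_eq_1: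
  assumes B: "lattice_basis B" and int: "\<And>z. lattice_point z \<Longrightarrow> r \<bullet> z \<in> \<int>"
    and w: "w \<in> B" "r \<bullet> w > 0" "\<And>b. b \<in> B \<Longrightarrow> b \<noteq> w \<Longrightarrow> r \<bullet> b = 0"
    and y: "lattice_point y" "r \<bullet> y = 1"
  shows "r \<bullet> w = 1"
proof -
  obtain c where "y = (\<Sum>b\<in>B. of_int (c b) *\<^sub>R b)"
    using B y(1) unfolding lattice_basis_def by blast
  then have "r \<bullet> y = (\<Sum>b\<in>B. of_int (c b) * (r \<bullet> b))"
    by (simp add: inner_sum_right)
  also have "\<dots> = (\<Sum>b\<in>B. if b = w then of_int (c w) * (r \<bullet> w) else 0)"
    using w(3) by (intro sum.cong) auto
  also have "\<dots> = of_int (c w) * (r \<bullet> w)"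
    using w(1) B by (simp add: lattice_basis_def)
  finally have 1: "of_int (c w) * (r \<bullet> w) = 1" using y(2) by simp
  have "r \<bullet> w \<in> \<int>" using int B w(1) by (simp add: lattice_basis_def)
  then obtain k :: int where k: "r \<bullet> w = of_int k" by (rule Ints_cases)
  have "of_int (k * c w) = (1 :: real)" using 1 by (simp add: k mult.commute)
  then have "k * c w = 1" by linarith
  moreover have "k > 0" using w(2) k by simp
  ultimately have "k = 1" using pos_zmult_eq_1_iff by blast
  then show ?thesis using k by simp
qed

text \<open>Otherwise one vector would be a proper fraction of the other.\<close>

lemma primitive_vec_parallel:
  assumes "primitive_vec u" "primitive_vec w" "u = c *\<^sub>R w" "c > 0"
  shows "u = w"
proof (cases c "1 :: real" rule: linorder_cases)
  case less
  then show ?thesis using assms by (auto simp: primitive_vec_def)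
next
  case greater
  then have "w = inverse c *\<^sub>R u" "0 < inverse c" "inverse c < 1"
    using assms by (simp_all add: inverse_less_1_iff)
  then show ?thesis using assms(1,2) unfolding primitive_vec_def by metis
qed (use assms in simp)

lemma primitive_vec_uminus: "primitive_vec u \<Longrightarrow> primitive_vec (- u)"
  by (simp add: primitive_vec_def lattice_point_def)

text \<open>By simplicity the segments to the neighbours \<open>V (toggle i S)\<close> are all the
  edges at \<open>V S\<close>. Each primitive direction follows one of them, no two follow the same
  one, and counting makes this a bijection.\<close>

lemma edge_directions:
  fixes P :: "(real^'n) set" and V :: "'n set \<Rightarrow> real^'n"
  assumes P: "smooth_polytope P" and V: "V S extreme_point_of P" "inj V"
    and edge: "\<And>i. closed_segment (V S) (V (toggle i S)) edge_of P"
  obtains d where "bij_betw d UNIV (prim_edge_dirs P (V S))"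
    "\<And>i. \<exists>c>0. d i = c *\<^sub>R (V (toggle i S) - V S)"
proof -
  define B where "B = prim_edge_dirs P (V S)"
  have B: "lattice_basis B" using P V(1) by (simp add: smooth_polytope_def B_def)
  let ?E = "{e. e edge_of P \<and> V S \<in> e}"
  let ?f = "\<lambda>i. closed_segment (V S) (V (toggle i S))"
  have card: "card ?E = CARD('n)"
    using P V(1) by (simp add: smooth_polytope_def simple_polytope_def)
  have "inj ?f"
  proof (rule injI)
    fix i j assume "?f i = ?f j"
    then have "V (toggle i S) = V (toggle j S)"
      by (auto simp: doubleton_eq_iff)
    then have "toggle i S = toggle j S" using V(2) by (simp add: inj_eq)
    then have "i \<in> toggle i S \<longleftrightarrow> i \<in> toggle j S" by simp
    then show "i = j" by auto
  qed
  then have "card (range ?f) = CARD('n)" by (simp add: card_image)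
  moreover have "range ?f \<subseteq> ?E" using edge by auto
  moreover have "finite ?E" using card by (simp add: card_ge_0_finite)
  ultimately have E: "?E = range ?f" using card by (metis card_subset_eq)
  have "\<exists>i. \<exists>c>0. b = c *\<^sub>R (V (toggle i S) - V S)" if b: "b \<in> B" for b
  proof -
    obtain e t where e: "e \<in> ?E" "t > 0" "V S + t *\<^sub>R b \<in> e" and "b \<noteq> 0"
      using b by (auto simp: B_def prim_edge_dirs_def primitive_vec_def)
    then obtain i where "V S + t *\<^sub>R b \<in> closed_segment (V S) (V (toggle i S))"
      using E by blast
    then obtain s where s: "0 \<le> s" "V S + t *\<^sub>R b = (1 - s) *\<^sub>R V S + s *\<^sub>R V (toggle i S)"
      by (auto simp: in_segment)
    then have tb: "t *\<^sub>R b = s *\<^sub>R (V (toggle i S) - V S)"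
      by (simp add: algebra_simps)
    then have "s \<noteq> 0" using e(2) \<open>b \<noteq> 0\<close> by auto
    then have "s / t > 0" using s(1) e(2) by simp
    moreover have "b = (s / t) *\<^sub>R (V (toggle i S) - V S)"
    proof -
      have "b = inverse t *\<^sub>R (t *\<^sub>R b)" using e(2) by simp
      then show ?thesis unfolding tb by (simp add: field_simps)
    qed
    ultimately show ?thesis by blast
  qed
  then obtain g c where g: "\<And>b. b \<in> B \<Longrightarrow> c b > 0"
      "\<And>b. b \<in> B \<Longrightarrow> b = c b *\<^sub>R (V (toggle (g b) S) - V S)"
    by metis
  have "inj_on g B"
  proof (rule inj_onI)
    fix a b assume ab: "a \<in> B" "b \<in> B" "g a = g b"
    let ?v = "V (toggle (g b) S) - V S"
    have "(c a / c b) *\<^sub>R b = (c a / c b) *\<^sub>R (c b *\<^sub>R ?v)" using g(2)[OF ab(2)] by simp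
    also have "\<dots> = a" using g(1)[OF ab(2)] g(2)[OF ab(1)] ab(3) by simp
    finally have "a = (c a / c b) *\<^sub>R b" by simp
    then show "a = b"
      using ab g(1) by (intro primitive_vec_parallel[of a b "c a / c b"])
        (auto simp: B_def prim_edge_dirs_def)
  qed
  moreover from this have "g ` B = UNIV"
    using B by (intro card_subset_eq) (auto simp: lattice_basis_def card_image)
  ultimately have bij: "bij_betw g B UNIV" by (simp add: bij_betw_def)
  have "bij_betw (inv_into B g) UNIV (prim_edge_dirs P (V S))"
    using bij_betw_inv_into[OF bij] by (simp add: B_def)
  moreover have "\<exists>c>0. inv_into B g i = c *\<^sub>R (V (toggle i S) - V S)" for i
  proof -
    have "inv_into B g i \<in> B" "g (inv_into B g i) = i"
      using bij by (auto simp: bij_betw_def intro!: inv_into_into f_inv_into_f)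
    then show ?thesis using g[of "inv_into B g i"] by metis
  qed
  ultimately show thesis by (rule that)
qed

lemma lattice_basis_expand:
  fixes B :: "(real^'n) set" and u :: "'n \<Rightarrow> real^'n"
  assumes B: "lattice_basis B" and u: "bij_betw u UNIV B"
    and p: "\<And>i j. p i \<bullet> u j = (if i = j then 1 else 0)"
  shows "x = (\<Sum>i\<in>UNIV. (p i \<bullet> x) *\<^sub>R u i)"
proof -
  have fin: "finite B" using B by (simp add: lattice_basis_def)
  have "dim B = dim (UNIV :: (real^'n) set)"
    using B by (simp add: lattice_basis_def dim_eq_card_independent)
  then have "span B = UNIV" by (metis dim_eq_full dim_UNIV)
  then obtain k where "x = (\<Sum>b\<in>B. k b *\<^sub>R b)"
    using span_finite[OF fin] by auto
  also have "\<dots> = (\<Sum>i\<in>UNIV. k (u i) *\<^sub>R u i)"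
    using sum.reindex_bij_betw[OF u, of "\<lambda>b. k b *\<^sub>R b"] by simp
  finally have x: "x = (\<Sum>i\<in>UNIV. k (u i) *\<^sub>R u i)" .
  have "p i \<bullet> x = k (u i)" for i
  proof -
    have "p i \<bullet> x = (\<Sum>j\<in>UNIV. k (u j) * (if i = j then 1 else 0))"
      by (subst x) (simp add: inner_sum_right p)
    then show ?thesis by (simp add: if_distrib cong: if_cong)
  qed
  then show ?thesis using x by simp
qed

lemma lattice_polytope_extreme_point:
  assumes "lattice_polytope P" "v extreme_point_of P"
  shows "lattice_point v"
  using assms extreme_point_of_convex_hull unfolding lattice_polytope_def by blast

lemma lattice_polytope_imp_polytope: "lattice_polytope P \<Longrightarrow> polytope P"
  unfolding lattice_polytope_def polytope_def by blast

section \<open>The frame of a smooth combinatorial cube\<close>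

lemma smooth_cube_frame:
  fixes C :: "(real^'n) set"
  assumes smooth: "smooth_polytope C" and cube: "comb_cube C"
  obtains u p q V where "dual_frame u p q" "dual_frame.cube_vertices p q C V"
    "\<And>S. V S extreme_point_of C"
proof -
  obtain V :: "'n set \<Rightarrow> real^'n" and F\<^sub>0 F\<^sub>1 where V: "\<And>S. V S extreme_point_of C"
    and F0: "\<And>i. F\<^sub>0 i face_of C" "\<And>S i. V S \<in> F\<^sub>0 i \<longleftrightarrow> i \<notin> S"
    and F1: "\<And>i. F\<^sub>1 i face_of C" "\<And>S i. V S \<in> F\<^sub>1 i \<longleftrightarrow> i \<in> S"
    and edge: "\<And>S i. closed_segment (V S) (V (toggle i S)) edge_of C"
    using comb_cube_labelling[OF cube] by metis
  have latt: "lattice_polytope C" using smooth by (simp add: smooth_polytope_def)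
  have poly: "polyhedron C"
    using lattice_polytope_imp_polytope[OF latt] by (rule polytope_imp_polyhedron)
  have VC: "V S \<in> C" for S using V by (simp add: extreme_point_of_def)
  have Vlatt: "lattice_point (V S)" for S
    using lattice_polytope_extreme_point[OF latt V] .
  have "inj V"
  proof (rule injI)
    fix S T assume "V S = V T"
    then have "i \<in> S \<longleftrightarrow> i \<in> T" for i using F1(2)[of S i] F1(2)[of T i] by simp
    then show "S = T" by blast
  qed
  then have "\<forall>S. \<exists>d. bij_betw d UNIV (prim_edge_dirs C (V S)) \<and>
      (\<forall>i. \<exists>c>0. d i = c *\<^sub>R (V (toggle i S) - V S))"
    using edge_directions[OF smooth V _ edge] by metis
  then obtain D where D: "\<And>S. bij_betw (D S) UNIV (prim_edge_dirs C (V S))"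
    and D_dir: "\<And>S i. \<exists>c>0. D S i = c *\<^sub>R (V (toggle i S) - V S)"
    by metis
  have basis: "lattice_basis (prim_edge_dirs C (V S))" for S
    using smooth V by (simp add: smooth_polytope_def)
  have D_mem: "D S i \<in> prim_edge_dirs C (V S)" for S i
    using D[of S] by (auto simp: bij_betw_def)
  have D_prim: "primitive_vec (D S i)" for S i
    using D_mem[of S i] by (simp add: prim_edge_dirs_def)
  have D_latt: "lattice_point (D S i)" for S i
    using D_prim[of S i] by (simp add: primitive_vec_def)
  \<comment> \<open>Seen from its two ends, an edge has opposite primitive directions.\<close>
  have D_toggle: "D (toggle i S) i = - D S i" for S i
  proof -
    obtain c where c: "c > 0" "D S i = c *\<^sub>R (V (toggle i S) - V S)" using D_dir by blast
    obtain c' where c': "c' > 0" "D (toggle i S) i = c' *\<^sub>R (V S - V (toggle i S))"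
      using D_dir[of "toggle i S" i] by auto
    have eq: "D (toggle i S) i = (c' / c) *\<^sub>R (- D S i)"
      using c(1) by (simp add: c(2) c'(2) scaleR_diff_right)
    show ?thesis
      by (rule primitive_vec_parallel[OF D_prim primitive_vec_uminus[OF D_prim] eq])
        (use c(1) c'(1) in simp)
  qed
  have int: "r \<bullet> z \<in> \<int>" if "\<And>i. r \<bullet> D S i \<in> \<int>" "lattice_point z" for r z S
  proof (rule lattice_basis_inner_int[OF basis _ that(2)])
    fix b assume "b \<in> prim_edge_dirs C (V S)"
    then obtain i where "b = D S i" using D[of S] by (auto simp: bij_betw_def)
    then show "r \<bullet> b \<in> \<int>" using that(1) by simp
  qed
  have eq_1: "r \<bullet> D S j = 1"
    if "\<And>z. lattice_point z \<Longrightarrow> r \<bullet> z \<in> \<int>" "r \<bullet> D S j > 0" "\<And>i. i \<noteq> j \<Longrightarrow> r \<bullet> D S i = 0"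
      "lattice_point y" "r \<bullet> y = 1" for r S j y
  proof (rule lattice_basis_inner_eq_1[OF basis that(1) D_mem that(2) _ that(4,5)])
    fix b assume b: "b \<in> prim_edge_dirs C (V S)" "b \<noteq> D S j"
    then obtain i where "b = D S i" using D[of S] by (auto simp: bij_betw_def)
    then show "r \<bullet> b = 0" using that(3)[of i] b by auto
  qed
  have "\<exists>n b. \<forall>x\<in>C. n \<bullet> x \<le> b \<and> (x \<in> F \<longleftrightarrow> n \<bullet> x = b)" if "F face_of C" for F
  proof -
    obtain n b where "C \<subseteq> {x. n \<bullet> x \<le> b}" "F = C \<inter> {x. n \<bullet> x = b}"
      using exposed_face_of_polyhedron[OF poly] \<open>F face_of C\<close> unfolding exposed_face_of_def by blast
    then show ?thesis by (intro exI[of _ n] exI[of _ b]) blast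
  qed
  then have "\<forall>F. \<exists>nb. F face_of C \<longrightarrow>
      (\<forall>x\<in>C. fst nb \<bullet> x \<le> snd nb \<and> (x \<in> F \<longleftrightarrow> fst nb \<bullet> x = snd nb))"
    by simp
  from choice[OF this] obtain h where h: "\<And>F. F face_of C \<Longrightarrow>
      \<forall>x\<in>C. fst (h F) \<bullet> x \<le> snd (h F) \<and> (x \<in> F \<longleftrightarrow> fst (h F) \<bullet> x = snd (h F))"
    by blast
  define N where "N F = fst (h F)" for F
  define b where "b F = snd (h F)" for F
  have N: "N F \<bullet> x \<le> b F" "x \<in> F \<longleftrightarrow> N F \<bullet> x = b F" if "F face_of C" "x \<in> C" for F x
    using h that by (simp_all add: N_def b_def)
  have N_zero: "N F \<bullet> D S i = 0" if "F face_of C" "V S \<in> F" "V (toggle i S) \<in> F" for F S i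
  proof -
    obtain c where "D S i = c *\<^sub>R (V (toggle i S) - V S)" using D_dir by blast
    then show ?thesis using N(2)[OF that(1) VC] that(2,3) by (simp add: inner_diff_right)
  qed
  have N_neg: "N F \<bullet> D S i < 0" if "F face_of C" "V S \<in> F" "V (toggle i S) \<notin> F" for F S i
  proof -
    obtain c where c: "c > 0" "D S i = c *\<^sub>R (V (toggle i S) - V S)" using D_dir by blast
    have "N F \<bullet> V S = b F" "N F \<bullet> V (toggle i S) < b F"
      using N[OF that(1) VC] that(2,3) by (auto simp: less_le)
    then show ?thesis using c by (simp add: inner_diff_right mult_pos_neg)
  qed
  define u where "u = D {}"
  \<comment> \<open>The scaling factor is negative for \<open>F\<^sub>0 i\<close> and positive for
    \<open>F\<^sub>1 i\<close>, so \<open>p i\<close> is an inner and \<open>q i\<close> an outer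
    normal, both with value 1 on \<open>u i\<close>.\<close>
  define p where "p i = (1 / (N (F\<^sub>0 i) \<bullet> u i)) *\<^sub>R N (F\<^sub>0 i)" for i
  define q where "q i = (1 / (N (F\<^sub>1 i) \<bullet> u i)) *\<^sub>R N (F\<^sub>1 i)" for i
  have N0u: "N (F\<^sub>0 i) \<bullet> u i < 0" for i
    unfolding u_def by (rule N_neg) (simp_all add: F0)
  have u': "u i = - D {i} i" for i using D_toggle[of i "{}"] by (simp add: u_def toggle_def)
  have N1u: "N (F\<^sub>1 i) \<bullet> u i > 0" for i
    using N_neg[OF F1(1), of "{i}" i i] by (simp add: F1 u')
  have p_zero: "p i \<bullet> D S j = 0" if "i \<notin> S" "i \<noteq> j" for i j S
    unfolding p_def using N_zero[OF F0(1), of S i j] that by (simp add: F0)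
  have q_zero: "q i \<bullet> D S j = 0" if "i \<in> S" "i \<noteq> j" for i j S
    unfolding q_def using N_zero[OF F1(1), of S i j] that by (simp add: F1)
  have p_pos: "p i \<bullet> D S i > 0" if "i \<notin> S" for i S
    unfolding p_def using N_neg[OF F0(1), of S i i] N0u[of i] that by (simp add: F0 divide_neg_neg)
  have q_neg: "q i \<bullet> D S i < 0" if "i \<in> S" for i S
    unfolding q_def using N_neg[OF F1(1), of S i i] N1u[of i] that by (simp add: F1 divide_neg_pos)
  have p_u: "p i \<bullet> u j = (if i = j then 1 else 0)" for i j
    using N0u[of j] p_zero[of i "{}" j] by (auto simp: p_def u_def)
  have q_u: "q i \<bullet> u i = 1" for i using N1u[of i] by (simp add: q_def)
  have p_int: "p i \<bullet> z \<in> \<int>" if "lattice_point z" for i z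
    by (rule int[of _ "{}", OF _ that]) (use p_u in \<open>auto simp: u_def\<close>)
  \<comment> \<open>At the vertex \<open>V {i}\<close>, \<open>q i\<close> is -1 on the direction
    \<open>i\<close> and 0 on the others, so it is integral on a lattice basis.\<close>
  have q_int: "q i \<bullet> z \<in> \<int>" if "lattice_point z" for i z
  proof (rule int[of _ "{i}", OF _ that])
    have "- (q i \<bullet> D {i} i) = 1" using q_u[of i] by (simp add: u')
    then have "q i \<bullet> D {i} i = - 1" by linarith
    then show "q i \<bullet> D {i} j \<in> \<int>" for j
      using q_zero[of i "{i}" j] by (cases "i = j") auto
  qed
  have frame: "dual_frame u p q"
  proof
    show "x = (\<Sum>i\<in>UNIV. (p i \<bullet> x) *\<^sub>R u i)" for x
      using lattice_basis_expand[OF basis D p_u[unfolded u_def]] unfolding u_def .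
    show "lattice_point (u i)" for i using D_latt by (simp add: u_def)
    fix j and S :: "'n set" assume j: "j \<notin> S"
    \<comment> \<open>The witness is the primitive direction from \<open>V S\<close> to its
      neighbour across \<open>j\<close>.\<close>
    let ?w = "D S j"
    have "p j \<bullet> ?w = 1"
      by (rule eq_1[of _ _ _ "u j"]) (use j p_int p_pos p_zero p_u D_latt in \<open>auto simp: u_def\<close>)
    \<comment> \<open>\<open>q j\<close> is evaluated from the far end of the edge, which lies on
      \<open>F\<^sub>1 j\<close>; there it vanishes on all directions but \<open>j\<close>.\<close>
    moreover have "(- q j) \<bullet> D (toggle j S) j = 1"
    proof (rule eq_1[of _ _ _ "- u j"])
      show "lattice_point (- u j)" using D_latt[of "{j}" j] by (simp add: u')
    qed (use j q_int q_neg q_zero q_u in auto)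
    then have "q j \<bullet> ?w = 1" by (simp add: D_toggle)
    moreover have "\<forall>i\<in>S. q i \<bullet> ?w = 0"
    proof
      fix i assume i: "i \<in> S"
      with j have "i \<noteq> j" by auto
      with i show "q i \<bullet> ?w = 0" by (rule q_zero)
    qed
    moreover have "\<forall>i. i \<notin> S \<longrightarrow> i \<noteq> j \<longrightarrow> p i \<bullet> ?w = 0" using p_zero by blast
    ultimately show "\<exists>w. p j \<bullet> w = 1 \<and> q j \<bullet> w = 1 \<and> (\<forall>i\<in>S. q i \<bullet> w = 0)
      \<and> (\<forall>i. i \<notin> S \<longrightarrow> i \<noteq> j \<longrightarrow> p i \<bullet> w = 0)" by blast
  qed (simp_all add: p_u q_u p_int q_int)
  have "q i \<in> normal_cone C {V S}" if "i \<in> S" for i S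
    using N[OF F1(1)[of i]] VC F1(2)[of S i] that N1u[of i]
    by (auto simp: normal_cone_def q_def divide_right_mono)
  moreover have "- p i \<in> normal_cone C {V S}" if "i \<notin> S" for i S
    using N[OF F0(1)[of i]] VC F0(2)[of S i] that N0u[of i]
    by (auto simp: normal_cone_def p_def divide_right_mono_neg)
  ultimately have "dual_frame.cube_vertices p q C V"
    unfolding dual_frame.cube_vertices_def[OF frame] using VC Vlatt by auto
  with frame show thesis using V by (rule that)
qed

theorem theorem4p7:
  fixes C C' :: "(real^'n) set"
  assumes "smooth_polytope C" and "smooth_polytope C'"
    and "comb_cube C" and "comb_cube C'"
    and "minkowski_equivalent C C'"
  shows "IDP_pair C C'"
proof -
  obtain u p q V where frame: "dual_frame u p q" and V: "dual_frame.cube_vertices p q C V"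
    and ext: "\<And>S. V S extreme_point_of C"
    using smooth_cube_frame[OF assms(1,3)] by metis
  interpret dual_frame u p q by (rule frame)
  have latt: "lattice_polytope C" "lattice_polytope C'"
    using assms(1,2) by (simp_all add: smooth_polytope_def)
  note poly = latt[THEN lattice_polytope_imp_polytope]
  \<comment> \<open>The normal cone of \<open>V S\<close> occurs in the common fan as the cone of
    some face \<open>G\<close> of \<open>C'\<close>. Any extreme point of \<open>C'\<close> in
    \<open>G\<close> is a lattice point whose cone contains that of \<open>G\<close>.\<close>
  have "\<exists>v\<in>C'. lattice_point v \<and> normal_cone C {V S} \<subseteq> normal_cone C' {v}" for S
  proof -
    have "normal_cone C {V S} \<in> normal_fan C"
      using ext[of S] by (auto simp: normal_fan_def face_of_singleton[symmetric])
    then have "normal_cone C {V S} \<in> normal_fan C'"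
      using assms(5) by (simp add: minkowski_equivalent_def)
    then obtain G where G: "normal_cone C {V S} = normal_cone C' G" "G face_of C'" "G \<noteq> {}"
      by (auto simp: normal_fan_def)
    obtain v where v: "v extreme_point_of C'" "v \<in> G"
      using polytope_nonempty_extreme_point[OF poly(2) G(2,3)] .
    then show ?thesis
      using G(1) lattice_polytope_extreme_point[OF latt(2) v(1)]
      by (auto simp: normal_cone_def extreme_point_of_def)
  qed
  then obtain V' where V': "\<And>S. V' S \<in> C'" "\<And>S. lattice_point (V' S)"
    "\<And>S. normal_cone C {V S} \<subseteq> normal_cone C' {V' S}"
    by metis
  have "cube_vertices C' V'"
    unfolding cube_vertices_def
  proof (intro allI conjI V')
    fix S i
    have "(if i \<in> S then q i else - p i) \<in> normal_cone C {V S}"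
      using V unfolding cube_vertices_def by blast
    then show "(if i \<in> S then q i else - p i) \<in> normal_cone C' {V' S}"
      using V'(3) by blast
  qed
  then show ?thesis
    using IDP_pair_cube_vertices[OF V] poly by (simp add: polytope_imp_convex)
qed

end
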